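(* There is a universal constant $\kappa>0$ such that the following holds. Let $t\ge 1$, $\mu>0$, $\sigma\ge 0$, $\delta\in[0,1]$, and let $n$ be large enough that $\delta n\ge 4(1+\log t)$. Let $\mathrm{Alg}$ be any permutation-invariant algorithm for $n$ workers. Then there exists an instance of the $\delta$-robust optimization problem with $n$ workers and variance bound $\sigma^2$, whose objective $f$ is $\mu$-strongly convex with minimizer $x^\star$, such that the output $\tilde x_t$ of $\mathrm{Alg}$ after $t$ rounds on this instance satisfies $$\mathbb{E}[f(\tilde x_t)]-f(x^\star)\ \ge\ \kappa\,\frac{\delta\sigma^2}{\mu}.$$
   Context: **$\delta$-robust optimization problem.** An instance consists of a function $f:\mathbb{R}^d\to\mathbb{R}$ that is $L$-smooth for some $L$ (i.e. $\|\nabla f(x)-\nabla f(y)\|\le L\|x-y\|$ for all $x,y$) and bounded below by $f^\star$, and $n$ workers, of which at least $(1-\delta)n$ are good (set $\mathcal G\subseteq[n]$); the remaining workers form the set $\mathcal B=[n]\setminus\mathcal G$ of Byzantine workers. The set $\mathcal B$ is fixed throughout all rounds. Optimization proceeds in rounds. In each round every good worker $i$ computes an independent stochastic gradient $g_i(x)$ at the current parameter $x$, with $\mathbb{E}[g_i(x)\mid x]=\nabla f(x)$ and $\mathbb{E}\|g_i(x)-\nabla f(x)\|^2\le\sigma^2$, and reports it to the server. Byzantine workers are omniscient (they see all computations of the good workers) and report arbitrary vectors; their behaviour is part of the instance. **Algorithm and permutation invariance.** Let $\tilde g_{i,s}$ be the vector reported by worker $i$ in round $s$ (the true stochastic gradient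 if $i\in\mathcal G$, an arbitrary vector if $i\in\mathcal B$). An algorithm $\mathrm{Alg}$ produces, after any number $s$ of rounds, an output which is a function of all vectors reported in rounds $1,\dots,s$; the parameter at which gradients are computed in the next round is produced by the algorithm in this way. $\mathrm{Alg}$ is permutation-invariant if for every number of rounds $s$ and all permutations $\pi_1,\dots,\pi_s$ of $[n]$, its output is unchanged when for each $r\le s$ the list $[\tilde g_{1,r},\dots,\tilde g_{n,r}]$ is replaced by $[\tilde g_{\pi_r(1),r},\dots,\tilde g_{\pi_r(n),r}]$. *)

theory Defs
  imports "HOL-Probability.Probability" "HOL-Combinatorics.List_Permutation"
begin

text \<open>
  The constant of the lower bound must not depend on the dimension \<open>d\<close>, so \<open>d\<close> has to be a bound
  variable rather than a type. Vectors of \<open>\<real>\<^sup>d\<close> are therefore functions on \<open>nat\<close> that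
  vanish from index \<open>d\<close> on, as in the library's \<^const>\<open>Euclidean_space\<close>. The class-level
  topology of \<open>nat \<Rightarrow> real\<close> is the product topology, which induces the Euclidean topology
  on this carrier, so \<open>borel\<close> is the right sigma-algebra; the class-level metric of
  \<open>nat \<Rightarrow> real\<close> is not Euclidean and is not used.
\<close>

type_synonym vec = "nat \<Rightarrow> real"

abbreviation Rn :: "nat \<Rightarrow> vec set" where
  "Rn d \<equiv> topspace (Euclidean_space d)"

definition edist :: "nat \<Rightarrow> vec \<Rightarrow> vec \<Rightarrow> real" where
  "edist d x y = L2_set (\<lambda>k. x k - y k) {..<d}"

definition has_gradient :: "nat \<Rightarrow> (vec \<Rightarrow> real) \<Rightarrow> vec \<Rightarrow> vec \<Rightarrow> bool" where
  "has_gradient d f v x \<longleftrightarrow>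
     v \<in> Rn d \<and>
     (\<forall>e>0. \<exists>r>0. \<forall>y\<in>Rn d. edist d y x < r \<longrightarrow>
        \<bar>f y - f x - (\<Sum>k<d. v k * (y k - x k))\<bar> \<le> e * edist d y x)"

definition smooth_with_gradient :: "nat \<Rightarrow> real \<Rightarrow> (vec \<Rightarrow> real) \<Rightarrow> (vec \<Rightarrow> vec) \<Rightarrow> bool" where
  "smooth_with_gradient d L f f' \<longleftrightarrow>
     (\<forall>x\<in>Rn d. has_gradient d f (f' x) x) \<and>
     (\<forall>x\<in>Rn d. \<forall>y\<in>Rn d. edist d (f' x) (f' y) \<le> L * edist d x y)"

definition strongly_convex :: "nat \<Rightarrow> real \<Rightarrow> (vec \<Rightarrow> real) \<Rightarrow> bool" where
  "strongly_convex d \<mu> f \<longleftrightarrow>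
     (\<forall>x\<in>Rn d. \<forall>y\<in>Rn d. \<forall>\<theta>. 0 \<le> \<theta> \<and> \<theta> \<le> 1 \<longrightarrow>
        f (\<lambda>k. \<theta> * x k + (1 - \<theta>) * y k)
          \<le> \<theta> * f x + (1 - \<theta>) * f y - \<mu> / 2 * \<theta> * (1 - \<theta>) * (edist d x y)\<^sup>2)"

text \<open>
  Workers are \<open>0, \<dots>, n - 1\<close> and rounds are counted from \<open>0\<close>. A transcript lists, round by round,
  the list of the \<open>n\<close> reported vectors. An algorithm maps the transcript of the first \<open>s\<close> rounds to
  its output after \<open>s\<close> rounds, which is also the parameter of the next round; the empty transcript
  gives the initial parameter.
\<close>

type_synonym transcript = "vec list list"
type_synonym algorithm = "transcript \<Rightarrow> vec"

definition is_transcript :: "nat \<Rightarrow> nat \<Rightarrow> transcript \<Rightarrow> bool" where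
  "is_transcript d n H \<longleftrightarrow> (\<forall>R\<in>set H. length R = n \<and> set R \<subseteq> Rn d)"

definition is_algorithm :: "nat \<Rightarrow> nat \<Rightarrow> algorithm \<Rightarrow> bool" where
  "is_algorithm d n Alg \<longleftrightarrow> (\<forall>H. is_transcript d n H \<longrightarrow> Alg H \<in> Rn d)"

definition permutation_invariant :: "nat \<Rightarrow> nat \<Rightarrow> algorithm \<Rightarrow> bool" where
  "permutation_invariant d n Alg \<longleftrightarrow>
     (\<forall>H \<pi>. is_transcript d n H \<and> (\<forall>r<length H. \<pi> r permutes {..<n}) \<longrightarrow>
        Alg (map (\<lambda>r. permute_list (\<pi> r) (H ! r)) [0..<length H]) = Alg H)"

text \<open>
  In each round a fresh seed is drawn from \<open>seed\<close>, independently of the other rounds. It carries all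
  randomness of that round: worker \<open>i\<close>, if good, computes \<open>sgrad i x \<omega>\<close> at parameter \<open>x\<close>, and
  the remaining randomness in the seed is available to the Byzantine workers. The latter are
  omniscient but cannot see the future: in round \<open>r\<close>, Byzantine worker \<open>i\<close> reports
  \<open>byz H x \<omega>s i\<close>, where \<open>H\<close> is the transcript of the previous \<open>r\<close> rounds, \<open>x\<close> the current
  parameter and \<open>\<omega>s\<close> the list of the seeds of all rounds up to and including \<open>r\<close>.
\<close>

type_synonym seed = "nat \<Rightarrow> real"

record robust_instance =
  obj :: "vec \<Rightarrow> real"
  grad :: "vec \<Rightarrow> vec"
  good :: "nat set"
  seed :: "seed measure"
  sgrad :: "nat \<Rightarrow> vec \<Rightarrow> seed \<Rightarrow> vec"
  byz :: "transcript \<Rightarrow> vec \<Rightarrow> seed list \<Rightarrow> nat \<Rightarrow> vec"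

text \<open>
  Since the parameter of a round is determined by earlier seeds, it is independent of the current
  seed; the conditions on \<open>sgrad\<close> at every fixed \<open>x\<close> are thus the conditions conditional on the
  current parameter. Joint measurability makes \<open>sgrad\<close> applicable to random parameters.
\<close>

definition stochastic_gradients :: "nat \<Rightarrow> real \<Rightarrow> robust_instance \<Rightarrow> bool" where
  "stochastic_gradients d \<sigma> I \<longleftrightarrow>
     prob_space (seed I) \<and>
     (\<forall>i\<in>good I.
        (\<lambda>(x, \<omega>). sgrad I i x \<omega>)
          \<in> borel_measurable (restrict_space borel (Rn d) \<Otimes>\<^sub>M seed I)) \<and>
     (\<forall>x\<in>Rn d.
        prob_space.indep_vars (seed I) (\<lambda>_. borel) (\<lambda>i. sgrad I i x) (good I) \<and>
        (\<forall>i\<in>good I.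
           (\<forall>\<omega>\<in>space (seed I). sgrad I i x \<omega> \<in> Rn d) \<and>
           (\<forall>k<d. has_bochner_integral (seed I) (\<lambda>\<omega>. sgrad I i x \<omega> k) (grad I x k)) \<and>
           integrable (seed I) (\<lambda>\<omega>. (edist d (sgrad I i x \<omega>) (grad I x))\<^sup>2) \<and>
           (\<integral>\<omega>. (edist d (sgrad I i x \<omega>) (grad I x))\<^sup>2 \<partial>seed I) \<le> \<sigma>\<^sup>2))"

definition is_robust_instance ::
    "nat \<Rightarrow> nat \<Rightarrow> real \<Rightarrow> real \<Rightarrow> robust_instance \<Rightarrow> bool" where
  "is_robust_instance d n \<delta> \<sigma> I \<longleftrightarrow>
     (\<exists>L. smooth_with_gradient d L (obj I) (grad I)) \<and>
     (\<exists>fstar. \<forall>x\<in>Rn d. fstar \<le> obj I x) \<and>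
     good I \<subseteq> {..<n} \<and>
     (1 - \<delta>) * real n \<le> real (card (good I)) \<and>
     stochastic_gradients d \<sigma> I \<and>
     (\<forall>i\<in>{..<n} - good I. \<forall>H. \<forall>x\<in>Rn d. \<forall>\<omega>s. byz I H x \<omega>s i \<in> Rn d)"

fun run_transcript ::
    "nat \<Rightarrow> algorithm \<Rightarrow> robust_instance \<Rightarrow> (nat \<Rightarrow> seed) \<Rightarrow> nat \<Rightarrow> transcript" where
  "run_transcript n Alg I \<omega> 0 = []"
| "run_transcript n Alg I \<omega> (Suc r) =
     (let H = run_transcript n Alg I \<omega> r; x = Alg H in
      H @ [map (\<lambda>i. if i \<in> good I then sgrad I i x (\<omega> r)
                    else byz I H x (map \<omega> [0..<Suc r]) i) [0..<n]])"

definition run_output ::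
    "nat \<Rightarrow> algorithm \<Rightarrow> robust_instance \<Rightarrow> nat \<Rightarrow> (nat \<Rightarrow> seed) \<Rightarrow> vec" where
  "run_output n Alg I s \<omega> = Alg (run_transcript n Alg I \<omega> s)"

definition run_space :: "robust_instance \<Rightarrow> nat \<Rightarrow> (nat \<Rightarrow> seed) measure" where
  "run_space I t = (\<Pi>\<^sub>M r\<in>{..<t}. seed I)"

text \<open>
  Neither the algorithm nor the Byzantine behaviour is assumed to be measurable. Instead, the
  following condition says that all reports and all outputs of a run are random variables.
\<close>

definition random_run :: "nat \<Rightarrow> algorithm \<Rightarrow> robust_instance \<Rightarrow> nat \<Rightarrow> bool" where
  "random_run n Alg I t \<longleftrightarrow>
     (\<forall>s\<le>t. run_output n Alg I s \<in> borel_measurable (run_space I t)) \<and>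
     (\<forall>r<t. \<forall>i<n. (\<lambda>\<omega>. run_transcript n Alg I \<omega> t ! r ! i) \<in> borel_measurable (run_space I t))"

end

theory Submission
  imports Defs
begin

text \<open>
  Two instances are driven by the same independent random bits, each equal to \<open>1\<close> with probability
  \<open>p = \<delta> / 4\<close>. In the first one all workers are good, the objective is
  \<open>\<mu> / 2 * \<parallel>x - c\<parallel>\<^sup>2\<close>, and worker \<open>i\<close> reports \<open>\<mu> x - G b\<^sub>i e\<^sub>0\<close>, where \<open>G\<close> is chosen
  such that \<open>G\<^sup>2 p = \<sigma>\<^sup>2\<close> and \<open>c = (G p / \<mu>) e\<^sub>0\<close> makes this unbiased. In the second one the
  objective is \<open>\<mu> / 2 * \<parallel>x\<parallel>\<^sup>2\<close> and good workers report the exact gradient \<open>\<mu> x\<close>; as many of the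
  Byzantine workers as there are ones among the bits report \<open>\<mu> x - G e\<^sub>0\<close>. As long as no round has
  more ones than there are Byzantine workers, the reports of both instances agree up to a
  permutation, so a permutation-invariant algorithm has the same output on both. By a Chernoff
  bound this fails in some round with probability at most \<open>1 / 2\<close>. A common output is far from one
  of the two minimizers, at squared distance of order \<open>(G p / \<mu>)\<^sup>2 = \<sigma>\<^sup>2 p / \<mu>\<^sup>2\<close>.
\<close>

section \<open>Quadratic objectives\<close>

definition quad :: "nat \<Rightarrow> real \<Rightarrow> vec \<Rightarrow> vec \<Rightarrow> real" where
  "quad d \<mu> c x = (\<Sum>k<d. \<mu> / 2 * (x k - c k)\<^sup>2)"

definition quad_grad :: "real \<Rightarrow> vec \<Rightarrow> vec \<Rightarrow> vec" where
  "quad_grad \<mu> c x = (\<lambda>k. \<mu> * (x k - c k))"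

lemma edist_sq: "(edist d x y)\<^sup>2 = (\<Sum>k<d. (x k - y k)\<^sup>2)"
  by (simp add: edist_def L2_set_def sum_nonneg)

lemma edist_nonneg: "0 \<le> edist d x y"
  by (simp add: edist_def)

lemma quad_nonneg: "0 \<le> \<mu> \<Longrightarrow> 0 \<le> quad d \<mu> c x"
  by (simp add: quad_def sum_nonneg)

lemma quad_center [simp]: "quad d \<mu> c c = 0"
  by (simp add: quad_def)

lemma quad_ge_coordinate:
  assumes "0 \<le> \<mu>" "k < d"
  shows "\<mu> / 2 * (x k - c k)\<^sup>2 \<le> quad d \<mu> c x"
  unfolding quad_def
  by (rule member_le_sum) (use assms in auto)

text \<open>The second-order Taylor expansion of a quadratic is exact, so the remainder is
  \<open>\<mu> / 2\<close> times the squared distance; the gradient map scales all distances by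
  exactly \<open>\<mu>\<close>.\<close>

lemma quad_smooth:
  assumes \<mu>: "0 < \<mu>" and c: "c \<in> Rn d"
  shows "smooth_with_gradient d \<mu> (quad d \<mu> c) (quad_grad \<mu> c)"
  unfolding smooth_with_gradient_def has_gradient_def
proof (intro conjI ballI allI impI)
  fix x assume "x \<in> Rn d"
  then show "quad_grad \<mu> c x \<in> Rn d"
    using c by (simp add: quad_grad_def topspace_Euclidean_space)
next
  fix x :: vec and e :: real assume e: "0 < e"
  have remainder: "\<bar>quad d \<mu> c y - quad d \<mu> c x - (\<Sum>k<d. quad_grad \<mu> c x k * (y k - x k))\<bar>
      = \<mu> / 2 * (edist d y x)\<^sup>2" for y
  proof -
    have "quad d \<mu> c y - quad d \<mu> c x - (\<Sum>k<d. quad_grad \<mu> c x k * (y k - x k))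
      = \<mu> / 2 * (edist d y x)\<^sup>2"
      unfolding quad_def quad_grad_def edist_sq sum_distrib_left sum_subtractf[symmetric]
      by (intro sum.cong refl) (simp add: field_simps power2_eq_square)
    then show ?thesis using \<mu> by (simp only:) simp
  qed
  show "\<exists>r>0. \<forall>y\<in>Rn d. edist d y x < r \<longrightarrow>
      \<bar>quad d \<mu> c y - quad d \<mu> c x - (\<Sum>k<d. quad_grad \<mu> c x k * (y k - x k))\<bar> \<le> e * edist d y x"
  \<comment> \<open>At this distance the quadratic remainder meets the linear bound with slope
    \<open>e\<close>.\<close>
  proof (intro exI[of _ "2 * e / \<mu>"] conjI ballI impI)
    show "0 < 2 * e / \<mu>" using e \<mu> by simp
    fix y assume "edist d y x < 2 * e / \<mu>"
    then have "\<mu> / 2 * edist d y x \<le> e" using \<mu> by (simp add: field_simps)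
    then have "\<mu> / 2 * edist d y x * edist d y x \<le> e * edist d y x"
      by (intro mult_right_mono edist_nonneg)
    then show "\<bar>quad d \<mu> c y - quad d \<mu> c x - (\<Sum>k<d. quad_grad \<mu> c x k * (y k - x k))\<bar>
        \<le> e * edist d y x"
      unfolding remainder by (simp add: power2_eq_square mult.assoc)
  qed
next
  fix x y :: vec
  have "(edist d (quad_grad \<mu> c x) (quad_grad \<mu> c y))\<^sup>2 = (\<mu> * edist d x y)\<^sup>2"
    unfolding power_mult_distrib edist_sq sum_distrib_left
    by (intro sum.cong refl) (simp add: quad_grad_def field_simps power2_eq_square)
  then have "edist d (quad_grad \<mu> c x) (quad_grad \<mu> c y) = \<mu> * edist d x y"
    using \<mu> by (simp add: edist_nonneg)
  then show "edist d (quad_grad \<mu> c x) (quad_grad \<mu> c y) \<le> \<mu> * edist d x y" by simp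
qed

text \<open>For this quadratic the defining inequality is an equality, a polynomial identity in each
  coordinate.\<close>

lemma quad_strongly_convex: "strongly_convex d \<mu> (quad d \<mu> c)"
  unfolding strongly_convex_def
proof (intro ballI allI impI)
  fix x y :: vec and \<theta> :: real
  have "quad d \<mu> c (\<lambda>k. \<theta> * x k + (1 - \<theta>) * y k)
      = \<theta> * quad d \<mu> c x + (1 - \<theta>) * quad d \<mu> c y - \<mu> / 2 * \<theta> * (1 - \<theta>) * (edist d x y)\<^sup>2"
    unfolding quad_def edist_sq sum_distrib_left sum_subtractf[symmetric] sum.distrib[symmetric]
    by (intro sum.cong refl) (simp add: field_simps power2_eq_square)
  then show "quad d \<mu> c (\<lambda>k. \<theta> * x k + (1 - \<theta>) * y k)
      \<le> \<theta> * quad d \<mu> c x + (1 - \<theta>) * quad d \<mu> c y - \<mu> / 2 * \<theta> * (1 - \<theta>) * (edist d x y)\<^sup>2"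
    by simp
qed

lemma quad_is_arg_min:
  assumes "0 \<le> \<mu>" "c \<in> Rn d"
  shows "is_arg_min (quad d \<mu> c) (\<lambda>x. x \<in> Rn d) c"
  using assms quad_nonneg[of \<mu> d c] by (auto simp: is_arg_min_def not_less)

section \<open>Random bits\<close>

lemma measurable_discrete:
  assumes "sets M = Pow (space M)" "f \<in> space M \<rightarrow> space N"
  shows "f \<in> measurable M N"
  using assms by (auto simp: measurable_def)

lemma (in finite_measure) integrable_discrete:
  fixes f :: "'a \<Rightarrow> real"
  assumes "sets M = Pow (space M)" "finite (space M)"
  shows "integrable M f"
proof -
  obtain B where "\<forall>x\<in>f ` space M. norm x \<le> B"
    using finite_imp_bounded[of "f ` space M"] assms(2) unfolding bounded_iff by blast
  then show ?thesis
    using assms(1) by (intro integrable_const_bound[of _ B] measurable_discrete) auto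
qed

text \<open>The bits are real because seeds are real sequences. The target
  \<open>count_space {0, 1}\<close> keeps the space finite and discrete, so that every real function
  of finitely many bits is measurable and integrable.\<close>

definition bern :: "real \<Rightarrow> real measure" where
  "bern p = distr (bernoulli_pmf p) (count_space {0, 1}) of_bool"

definition bits :: "nat \<Rightarrow> real \<Rightarrow> seed measure" where
  "bits n p = (\<Pi>\<^sub>M i\<in>{..<n}. bern p)"

lemma space_bern [simp]: "space (bern p) = {0, 1}"
  and sets_bern [measurable_cong]: "sets (bern p) = sets (count_space {0, 1})"
  by (simp_all add: bern_def)

lemma prob_space_bern: "prob_space (bern p)"
  unfolding bern_def by (rule prob_space.prob_space_distr) (auto simp: prob_space_measure_pmf)

lemma integrable_bern: "integrable (bern p) (f :: real \<Rightarrow> real)"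
proof -
  interpret prob_space "bern p" by (rule prob_space_bern)
  show ?thesis by (rule integrable_discrete) (auto simp: sets_bern)
qed

lemma integral_bern:
  fixes f :: "real \<Rightarrow> real"
  assumes "0 \<le> p" "p \<le> 1"
  shows "(\<integral>x. f x \<partial>bern p) = f 1 * p + f 0 * (1 - p)"
  unfolding bern_def using assms by (subst integral_distr) auto

lemma finite_product_prob_space_bern:
  "finite I \<Longrightarrow> finite_product_prob_space (\<lambda>_. bern p) I"
  by (intro finite_product_prob_space.intro product_prob_space.intro product_prob_space_axioms.intro
    finite_product_sigma_finite.intro finite_product_sigma_finite_axioms.intro
    product_sigma_finite.intro prob_space_imp_sigma_finite prob_space_bern)

lemma space_bits: "space (bits n p) = {..<n} \<rightarrow>\<^sub>E {0, 1}"
  by (simp add: bits_def space_PiM)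

lemma sets_bits: "sets (bits n p) = Pow (space (bits n p))"
proof -
  have "sets (bits n p) = sets (\<Pi>\<^sub>M i\<in>{..<n}. count_space {0, 1 :: real})"
    unfolding bits_def by (intro sets_PiM_cong sets_bern refl)
  then show ?thesis
    by (simp add: count_space_PiM_finite space_bits)
qed

lemma finite_space_bits: "finite (space (bits n p))"
  unfolding space_bits by (intro finite_PiE) auto

lemma prob_space_bits: "prob_space (bits n p)"
  unfolding bits_def by (intro prob_space_PiM prob_space_bern)

lemma integrable_bits: "integrable (bits n p) (f :: seed \<Rightarrow> real)"
proof -
  interpret prob_space "bits n p" by (rule prob_space_bits)
  show ?thesis by (rule integrable_discrete[OF sets_bits finite_space_bits])
qed

lemma component_measurable_bits: "i < n \<Longrightarrow> (\<lambda>\<omega>. \<omega> i) \<in> borel_measurable (bits n p)"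
  by (rule measurable_discrete[OF sets_bits]) auto

lemma bits_component_cases:
  assumes "\<omega> \<in> space (bits n p)" "i < n"
  shows "\<omega> i = 0 \<or> \<omega> i = 1"
  using PiE_mem[of \<omega> "{..<n}" "\<lambda>_. {0, 1}" i] assms unfolding space_bits by auto

lemma integral_bits_component:
  fixes f :: "real \<Rightarrow> real"
  assumes "i < n" "0 \<le> p" "p \<le> 1"
  shows "(\<integral>\<omega>. f (\<omega> i) \<partial>bits n p) = f 1 * p + f 0 * (1 - p)"
proof -
  have "(\<integral>\<omega>. f (\<omega> i) \<partial>bits n p) = (\<integral>x. f x \<partial>distr (bits n p) (bern p) (\<lambda>\<omega>. \<omega> i))"
    using assms by (subst integral_distr) (auto simp: bits_def sets_bern)
  also have "distr (bits n p) (bern p) (\<lambda>\<omega>. \<omega> i) = bern p"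
    unfolding bits_def using assms by (intro distr_PiM_component prob_space_bern) auto
  finally show ?thesis using assms by (simp add: integral_bern)
qed

text \<open>The joint law of the coordinates of a product space is the product measure itself, so
  the coordinates are independent, and functions of separate bits inherit this.\<close>

lemma indep_vars_bits:
  assumes "\<And>i. i < n \<Longrightarrow> f i \<in> measurable (bern p) (N i)"
  shows "prob_space.indep_vars (bits n p) N (\<lambda>i \<omega>. f i (\<omega> i)) {..<n}"
proof -
  interpret prob_space "bits n p" by (rule prob_space_bits)
  have "indep_vars (\<lambda>_. bern p) (\<lambda>i \<omega>. \<omega> i) {..<n}"
  \<comment> \<open>The criterion through the joint law presupposes a nonempty index set.\<close>
  proof (cases "n = 0")
    case True
    then show ?thesis unfolding indep_vars_def2 indep_sets_def by auto
  next
    case False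
    have "distr (bits n p) (\<Pi>\<^sub>M i\<in>{..<n}. bern p) (\<lambda>\<omega>. \<lambda>i\<in>{..<n}. \<omega> i)
        = distr (bits n p) (bits n p) (\<lambda>\<omega>. \<omega>)"
      by (intro distr_cong) (auto simp: space_bits bits_def[symmetric])
    also have "\<dots> = (\<Pi>\<^sub>M i\<in>{..<n}. distr (bits n p) (bern p) (\<lambda>\<omega>. \<omega> i))"
      unfolding distr_id bits_def
      by (intro PiM_cong refl distr_PiM_component[symmetric] prob_space_bern)
    finally show ?thesis
      using False by (subst indep_vars_iff_distr_eq_PiM') (auto simp: bits_def lessThan_empty_iff)
  qed
  then show ?thesis
    by (rule indep_vars_compose2) (use assms in auto)
qed

section \<open>Number of ones\<close>

definition ones :: "nat \<Rightarrow> seed \<Rightarrow> nat" where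
  "ones n \<omega> = card {i. i < n \<and> \<omega> i = 1}"

lemma ones_eq_sum:
  assumes "\<omega> \<in> space (bits n p)"
  shows "real (ones n \<omega>) = (\<Sum>i<n. \<omega> i)"
proof -
  have "(\<Sum>i<n. \<omega> i) = (\<Sum>i<n. if \<omega> i = 1 then 1 else 0)"
    using bits_component_cases[OF assms] by (intro sum.cong) auto
  also have "\<dots> = real (card ({..<n} \<inter> {i. \<omega> i = 1}))"
    by (simp add: sum.If_cases)
  also have "{..<n} \<inter> {i. \<omega> i = 1} = {i. i < n \<and> \<omega> i = 1}" by auto
  finally show ?thesis by (simp add: ones_def)
qed

text \<open>Chernoff bound with exponent 1: each bit has exponential moment
  \<open>1 + p * (exp 1 - 1)\<close>, which is at most \<open>exp (2 * p)\<close> because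
  \<open>exp 1 \<le> 3\<close>. Independence multiplies the moments, and Markov's inequality
  finishes.\<close>

lemma ones_tail:
  assumes p: "0 \<le> p" "p \<le> 1"
  shows "measure (bits n p) {\<omega>\<in>space (bits n p). s \<le> real (ones n \<omega>)} \<le> exp (2 * p * n - s)"
proof -
  interpret finite_product_prob_space "\<lambda>_. bern p" "{..<n}"
    by (rule finite_product_prob_space_bern) simp
  have set_eq: "{\<omega>\<in>space (bits n p). s \<le> real (ones n \<omega>)}
      = {\<omega>\<in>space (bits n p). (\<Prod>i<n. exp (\<omega> i)) \<ge> exp s}"
    by (auto simp: ones_eq_sum exp_sum[symmetric])
  have "(\<integral>\<omega>. (\<Prod>i<n. exp (\<omega> i)) \<partial>bits n p) = (\<Prod>i<n. \<integral>x. exp x \<partial>bern p)"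
    unfolding bits_def by (rule product_integral_prod) (auto intro: integrable_bern)
  also have "\<dots> = (1 + p * (exp 1 - 1)) ^ n"
    using p by (simp add: integral_bern algebra_simps)
  also have "\<dots> \<le> exp (2 * p) ^ n"
  proof (rule power_mono)
    have "p * (exp 1 - 1) \<le> p * 2"
      using exp_le p by (intro mult_left_mono) auto
    also have "1 + p * 2 \<le> exp (2 * p)"
      using exp_ge_add_one_self[of "2 * p"] by linarith
    finally show "1 + p * (exp 1 - 1) \<le> exp (2 * p)" by simp
  qed (use p in simp)
  finally have mgf: "(\<integral>\<omega>. (\<Prod>i<n. exp (\<omega> i)) \<partial>bits n p) \<le> exp (2 * p * n)"
    by (simp add: exp_of_nat_mult[symmetric] mult.commute)
  have "measure (bits n p) {\<omega>\<in>space (bits n p). (\<Prod>i<n. exp (\<omega> i)) \<ge> exp s}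
      \<le> (\<integral>\<omega>. (\<Prod>i<n. exp (\<omega> i)) \<partial>bits n p) / exp s"
    by (rule integral_Markov_inequality_measure[where A = "{}"])
      (auto intro!: integrable_bits prod_nonneg AE_I2)
  also have "\<dots> \<le> exp (2 * p * n) / exp s"
    by (intro divide_right_mono mgf) simp
  finally show ?thesis unfolding set_eq exp_diff .
qed

text \<open>A list of zeros and ones is determined up to order by its number of ones. Here the ones
  are moved to the front, where the Byzantine workers sit.\<close>

lemma mset_bits:
  assumes "\<omega> \<in> space (bits n p)"
  shows "mset (map (\<lambda>i. of_bool (i < ones n \<omega>)) [0..<n]) = mset (map \<omega> [0..<n])"
proof (rule multiset_eqI)
  fix y :: real
  have count: "count (mset (map f [0..<n])) y = card {i. i < n \<and> f i = y}" for f :: "nat \<Rightarrow> real"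
  proof -
    have "{i. i < length (map f [0..<n]) \<and> y = map f [0..<n] ! i} = {i. i < n \<and> f i = y}"
      by auto
    then show ?thesis
      by (simp only: count_mset count_list_eq_length_filter length_filter_conv_card)
  qed
  have le: "ones n \<omega> \<le> n"
    unfolding ones_def using card_mono[of "{..<n}" "{i. i < n \<and> \<omega> i = 1}"] by auto
  have split: "card {i. i < n \<and> P i} + card {i. i < n \<and> \<not> P i} = n" for P
  proof -
    have "card {i. i < n \<and> P i} + card {i. i < n \<and> \<not> P i}
        = card ({i. i < n \<and> P i} \<union> {i. i < n \<and> \<not> P i})"
      by (rule card_Un_disjoint[symmetric]) auto
    also have "{i. i < n \<and> P i} \<union> {i. i < n \<and> \<not> P i} = {..<n}" by auto
    finally show ?thesis by simp
  qed
  have 1: "card {i. i < n \<and> i < ones n \<omega>} = card {i. i < n \<and> \<omega> i = 1}"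
  proof -
    have "{i. i < n \<and> i < ones n \<omega>} = {..<ones n \<omega>}" using le by auto
    then show ?thesis by (simp add: ones_def)
  qed
  have 0: "card {i. i < n \<and> \<not> i < ones n \<omega>} = card {i. i < n \<and> \<omega> i \<noteq> 1}"
    using 1 split[of "\<lambda>i. i < ones n \<omega>"] split[of "\<lambda>i. \<omega> i = 1"] by linarith
  have zero: "{i. i < n \<and> \<omega> i = 0} = {i. i < n \<and> \<omega> i \<noteq> 1}"
    using bits_component_cases[OF assms] by auto
  consider "y = 0" | "y = 1" | "y \<noteq> 0" "y \<noteq> 1" by blast
  then show "count (mset (map (\<lambda>i. of_bool (i < ones n \<omega>)) [0..<n])) y
      = count (mset (map \<omega> [0..<n])) y"
  proof cases
    case 1
    then show ?thesis unfolding count using 0 zero by (simp add: not_less)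
  next
    case 2
    then show ?thesis unfolding count using 1 by simp
  next
    case 3
    then have "{i. i < n \<and> \<omega> i = y} = {}" "{i. i < n \<and> of_bool (i < ones n \<omega>) = y} = {}"
      using bits_component_cases[OF assms] by auto
    then show ?thesis unfolding count by (simp only:)
  qed
qed

section \<open>Runs on random bits\<close>

lemma space_run_space:
  "seed I = bits n p \<Longrightarrow> space (run_space I t) = {..<t} \<rightarrow>\<^sub>E space (bits n p)"
  by (simp add: run_space_def space_PiM)

lemma sets_run_space:
  assumes "seed I = bits n p"
  shows "sets (run_space I t) = Pow (space (run_space I t))"
proof -
  have "sets (run_space I t) = sets (\<Pi>\<^sub>M r\<in>{..<t}. count_space (space (bits n p)))"
    unfolding run_space_def assms by (intro sets_PiM_cong refl) (simp add: sets_bits)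
  then show ?thesis
    by (simp add: count_space_PiM_finite finite_space_bits countable_finite space_run_space[OF assms])
qed

lemma finite_space_run_space: "seed I = bits n p \<Longrightarrow> finite (space (run_space I t))"
  by (simp add: space_run_space finite_PiE finite_space_bits)

lemma prob_space_run_space: "seed I = bits n p \<Longrightarrow> prob_space (run_space I t)"
  unfolding run_space_def by (intro prob_space_PiM) (simp add: prob_space_bits)

lemma integrable_run_space:
  assumes "seed I = bits n p"
  shows "integrable (run_space I t) (f :: _ \<Rightarrow> real)"
proof -
  interpret prob_space "run_space I t" by (rule prob_space_run_space[OF assms])
  show ?thesis
    by (rule integrable_discrete[OF sets_run_space[OF assms] finite_space_run_space[OF assms]])
qed

text \<open>The run space is finite and discrete, so every report and every output is a random
  variable, whatever the algorithm and the Byzantine workers do.\<close>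

lemma random_run_bits: "seed I = bits n p \<Longrightarrow> random_run n Alg I t"
  unfolding random_run_def by (auto intro!: measurable_discrete sets_run_space)

text \<open>Rounds are independent, so the event has probability \<open>(1 - q) ^ t\<close>, where
  \<open>q\<close> is the failure probability of one round; Bernoulli's inequality bounds this below
  by \<open>1 - t * q\<close>.\<close>

lemma few_ones_prob:
  assumes I: "seed I = bits n p" and p: "0 \<le> p" "p \<le> 1"
    and t: "1 \<le> t" and s: "2 * p * n + 2 * (1 + ln (real t)) \<le> s"
  shows "1 / 2 \<le> measure (run_space I t)
    ({..<t} \<rightarrow>\<^sub>E {\<omega>\<in>space (bits n p). real (ones n \<omega>) < s})"
proof -
  interpret B: prob_space "bits n p" by (rule prob_space_bits)
  interpret finite_product_prob_space "\<lambda>_. bits n p" "{..<t}"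
    by unfold_locales auto
  let ?A = "{\<omega>\<in>space (bits n p). real (ones n \<omega>) < s}"
  define q where "q = measure (bits n p) (space (bits n p) - ?A)"
  have q_prob: "measure (bits n p) ?A = 1 - q"
    unfolding q_def by (subst B.prob_compl) (auto simp: sets_bits)
  have "space (bits n p) - ?A = {\<omega>\<in>space (bits n p). s \<le> real (ones n \<omega>)}" by auto
  then have "q \<le> exp (2 * p * n - s)"
    unfolding q_def using ones_tail[OF p] by simp
  \<comment> \<open>The margin \<open>2 * (1 + ln t)\<close> of the threshold over
    \<open>2 * p * n\<close> turns into the factor \<open>exp (- 2) / t^2\<close>, small enough to
    be multiplied by the number of rounds.\<close>
  also have "\<dots> \<le> exp (- 2 - 2 * ln (real t))"
    using s by simp
  also have "\<dots> = exp (- 2) / (real t)\<^sup>2"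
    using t by (simp add: exp_diff exp_double)
  finally have q: "q \<le> exp (- 2) / (real t)\<^sup>2" .
  have "real t * q \<le> real t * (exp (- 2) / (real t)\<^sup>2)"
    using q by (intro mult_left_mono) auto
  also have "\<dots> = exp (- 2) / real t" using t by (simp add: power2_eq_square)
  also have "\<dots> \<le> exp (- 2)" using t by (simp add: field_simps)
  also have "\<dots> \<le> 1 / 2"
    using exp_ge_add_one_self[of 2] by (simp add: exp_minus field_simps)
  finally have "1 / 2 \<le> 1 + real t * (- q)" by simp
  also have "\<dots> \<le> (1 + (- q)) ^ t"
    by (rule Bernoulli_inequality) (simp add: q_def)
  also have "\<dots> = measure (run_space I t) ({..<t} \<rightarrow>\<^sub>E ?A)"
    unfolding run_space_def I by (subst finite_measure_PiM_emb) (auto simp: sets_bits q_prob)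
  finally show ?thesis .
qed

text \<open>Equal multisets in a round give a permutation for that round, and invariance allows a
  different permutation in each round. In this form the two runs can be compared without exhibiting
  permutations.\<close>

lemma permutation_invariantD:
  assumes inv: "permutation_invariant d n Alg" and H: "is_transcript d n H"
    and eq: "list_all2 (\<lambda>R R'. mset R = mset R') H' H"
  shows "Alg H' = Alg H"
proof -
  have len: "length H' = length H" using eq by (rule list_all2_lengthD)
  have "\<exists>p. p permutes {..<n} \<and> permute_list p (H ! r) = H' ! r" if "r < length H" for r
  proof -
    have "mset (H' ! r) = mset (H ! r)" using list_all2_nthD[OF eq] that len by simp
    moreover have "length (H ! r) = n" using H that by (simp add: is_transcript_def)
    ultimately show ?thesis by (metis mset_eq_permutation)
  qed
  then obtain \<pi> where \<pi>: "\<And>r. r < length H \<Longrightarrow> \<pi> r permutes {..<n}"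
    "\<And>r. r < length H \<Longrightarrow> permute_list (\<pi> r) (H ! r) = H' ! r" by metis
  have "Alg (map (\<lambda>r. permute_list (\<pi> r) (H ! r)) [0..<length H]) = Alg H"
    using inv H \<pi>(1) by (simp add: permutation_invariant_def)
  also have "map (\<lambda>r. permute_list (\<pi> r) (H ! r)) [0..<length H] = H'"
    using \<pi>(2) len by (intro nth_equalityI) auto
  finally show ?thesis .
qed

section \<open>The two indistinguishable instances\<close>

text \<open>The probability \<open>p\<close> of a one stays a free parameter here; the theorem
  instantiates it with \<open>\<delta> / 4\<close>.\<close>

locale lower_bound =
  fixes d n :: nat and \<mu> \<sigma> \<delta> p :: real
  assumes d: "1 \<le> d" and \<mu>: "0 < \<mu>" and \<delta>: "0 \<le> \<delta>" "\<delta> \<le> 1"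
    and p: "0 < p" "p \<le> 1"
begin

definition G :: real where "G = \<sigma> / sqrt p"

text \<open>The largest number of Byzantine workers that the bound on the good ones permits.\<close>

definition K :: nat where "K = nat \<lfloor>\<delta> * real n\<rfloor>"

definition center :: vec where "center = (\<lambda>k. if k = 0 then G * p / \<mu> else 0)"

text \<open>One formula for every vector that occurs: a random bit \<open>b\<close> gives a noisy
  report, \<open>b = p\<close> its mean, and \<open>b = 0\<close> the exact gradient of the attacked
  instance.\<close>

definition report :: "vec \<Rightarrow> real \<Rightarrow> vec" where
  "report x b = (\<lambda>k. \<mu> * x k - (if k = 0 then G * b else 0))"

definition noisy :: robust_instance where
  "noisy = \<lparr>obj = quad d \<mu> center, grad = quad_grad \<mu> center, good = {..<n}, seed = bits n p,
     sgrad = (\<lambda>i x \<omega>. report x (\<omega> i)), byz = (\<lambda>_ _ _ _ _. 0)\<rparr>"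

text \<open>The seed is that of \<open>noisy\<close>, so both runs live on one probability space.
  The Byzantine workers are those below \<open>K\<close>; \<open>last \<omega>s\<close> is the seed
  of the current round, whose ones they count.\<close>

definition attacked :: robust_instance where
  "attacked = \<lparr>obj = quad d \<mu> (\<lambda>_. 0), grad = quad_grad \<mu> (\<lambda>_. 0), good = {K..<n}, seed = bits n p,
     sgrad = (\<lambda>_ x _. report x 0),
     byz = (\<lambda>_ x \<omega>s i. report x (of_bool (i < ones n (last \<omega>s))))\<rparr>"

lemma center_in: "center \<in> Rn d"
  using d by (simp add: center_def topspace_Euclidean_space)

lemma zero_in: "(\<lambda>_. 0) \<in> Rn d"
  by (simp add: topspace_Euclidean_space)

lemma report_in: "x \<in> Rn d \<Longrightarrow> report x b \<in> Rn d"
  using d by (simp add: report_def topspace_Euclidean_space)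

lemma K_le: "real K \<le> \<delta> * real n"
  using \<delta> by (simp add: K_def)

lemma less_Suc_K: "\<delta> * real n < real K + 1"
  using \<delta> unfolding K_def by simp

lemma K_le_n: "K \<le> n"
proof -
  have "\<delta> * real n \<le> 1 * real n" using \<delta> by (intro mult_right_mono) auto
  then show ?thesis using K_le by simp
qed

text \<open>A report is affine in its bit, so its mean is the report at the mean \<open>p\<close> of
  the bit; the choice of \<open>center\<close> makes this the gradient.\<close>

lemma report_grad: "report x p = quad_grad \<mu> center x"
  using \<mu> by (auto simp: report_def quad_grad_def center_def right_diff_distrib)

lemma report_0: "report x 0 = quad_grad \<mu> (\<lambda>_. 0) x"
  by (auto simp: report_def quad_grad_def)

lemma G_sq: "G\<^sup>2 * p = \<sigma>\<^sup>2"
  using p by (simp add: G_def power_divide)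

text \<open>The noise is confined to coordinate 0, hence the variance does not grow with
  \<open>d\<close>.\<close>

lemma edist_report: "(edist d (report x a) (report x b))\<^sup>2 = G\<^sup>2 * (a - b)\<^sup>2"
proof -
  have "(edist d (report x a) (report x b))\<^sup>2 = (\<Sum>k<d. if k = 0 then G\<^sup>2 * (a - b)\<^sup>2 else 0)"
    unfolding edist_sq
    by (intro sum.cong refl) (simp add: report_def power2_eq_square algebra_simps)
  then show ?thesis using d by simp
qed

text \<open>The topology on vectors is the product topology, so joint measurability may be checked
  coordinatewise.\<close>

lemma measurable_report:
  assumes "b \<in> borel_measurable (bits n p)"
  shows "(\<lambda>(x, \<omega>). report x (b \<omega>)) \<in> borel_measurable (restrict_space borel (Rn d) \<Otimes>\<^sub>M bits n p)"
proof (rule measurable_coordinatewise_then_product)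
  fix k
  have [measurable]: "(\<lambda>x. x k) \<in> borel_measurable (restrict_space borel (Rn d) :: vec measure)"
    by (intro measurable_restrict_space1 borel_measurable_continuous_onI
      continuous_on_product_coordinates)
  note assms[measurable]
  show "(\<lambda>xa. (case xa of (x, \<omega>) \<Rightarrow> report x (b \<omega>)) k)
      \<in> borel_measurable (restrict_space borel (Rn d) \<Otimes>\<^sub>M bits n p)"
    unfolding report_def case_prod_beta by measurable
qed

section \<open>Validity of the two instances\<close>

lemma noisy_is_instance: "is_robust_instance d n \<delta> \<sigma> noisy"
proof -
  have "stochastic_gradients d \<sigma> noisy"
    unfolding stochastic_gradients_def noisy_def robust_instance.simps
  proof (intro conjI ballI allI impI)
    show "prob_space (bits n p)" by (rule prob_space_bits)
    show "prob_space.indep_vars (bits n p) (\<lambda>_. borel) (\<lambda>i \<omega>. report x (\<omega> i)) {..<n}" for x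
      by (rule indep_vars_bits[where f = "\<lambda>_. report x"])
        (auto intro: measurable_discrete simp: sets_bern)
  next
    fix i assume i: "i \<in> {..<n}"
    show "(\<lambda>(x, \<omega>). report x (\<omega> i))
        \<in> borel_measurable (restrict_space borel (Rn d) \<Otimes>\<^sub>M bits n p)"
      using i by (intro measurable_report component_measurable_bits) simp
    fix x assume x: "x \<in> Rn d"
    show "report x (\<omega> i) \<in> Rn d" for \<omega> by (rule report_in[OF x])
    show "has_bochner_integral (bits n p) (\<lambda>\<omega>. report x (\<omega> i) k) (quad_grad \<mu> center x k)" for k
      using i p integral_bits_component[of i n p "\<lambda>b. report x b k"]
      by (auto simp: has_bochner_integral_iff integrable_bits report_grad[symmetric] report_def
        algebra_simps)
    show "integrable (bits n p) (\<lambda>\<omega>. (edist d (report x (\<omega> i)) (quad_grad \<mu> center x))\<^sup>2)"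
      by (rule integrable_bits)
    \<comment> \<open>The variance of a Bernoulli bit scaled by \<open>G\<close>, namely
      \<open>G^2 * p * (1 - p)\<close>.\<close>
    have "(\<integral>\<omega>. (edist d (report x (\<omega> i)) (quad_grad \<mu> center x))\<^sup>2 \<partial>bits n p)
        = G\<^sup>2 * (1 - p)\<^sup>2 * p + G\<^sup>2 * p\<^sup>2 * (1 - p)"
      unfolding report_grad[symmetric] edist_report
      using i p integral_bits_component[of i n p "\<lambda>b. G\<^sup>2 * (b - p)\<^sup>2"] by simp
    also have "\<dots> = \<sigma>\<^sup>2 * (1 - p)"
      unfolding G_sq[symmetric] by (simp add: power2_eq_square algebra_simps)
    also have "\<dots> \<le> \<sigma>\<^sup>2" using p by (simp add: mult_left_le)
    finally show "(\<integral>\<omega>. (edist d (report x (\<omega> i)) (quad_grad \<mu> center x))\<^sup>2 \<partial>bits n p) \<le> \<sigma>\<^sup>2" .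
  qed
  moreover have "(1 - \<delta>) * real n \<le> real n" using \<delta> by (simp add: mult_left_le_one_le)
  ultimately show ?thesis
    unfolding is_robust_instance_def
    using quad_smooth[OF \<mu> center_in] quad_nonneg[of \<mu> d center] \<mu>
    by (auto simp: noisy_def intro: less_imp_le)
qed

lemma attacked_is_instance: "is_robust_instance d n \<delta> \<sigma> attacked"
proof -
  have "stochastic_gradients d \<sigma> attacked"
    unfolding stochastic_gradients_def attacked_def robust_instance.simps
  proof (intro conjI ballI allI impI)
    interpret prob_space "bits n p" by (rule prob_space_bits)
    show "prob_space (bits n p)" by (rule prob_space_bits)
    \<comment> \<open>Deterministic reports are constant functions of the independent bits.\<close>
    show "indep_vars (\<lambda>_. borel) (\<lambda>i \<omega>. report x 0) {K..<n}" for x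
      by (rule indep_vars_subset[OF indep_vars_bits[where f = "\<lambda>_ _. report x 0"]]) auto
    show "(\<lambda>(x, \<omega>). report x 0)
        \<in> borel_measurable (restrict_space borel (Rn d) \<Otimes>\<^sub>M bits n p)"
      by (intro measurable_report) simp
    fix x assume x: "x \<in> Rn d"
    show "report x 0 \<in> Rn d" by (rule report_in[OF x])
    show "has_bochner_integral (bits n p) (\<lambda>\<omega>. report x 0 k) (quad_grad \<mu> (\<lambda>_. 0) x k)" for k
      by (simp add: has_bochner_integral_iff report_0 prob_space)
    show "integrable (bits n p) (\<lambda>\<omega>. (edist d (report x 0) (quad_grad \<mu> (\<lambda>_. 0) x))\<^sup>2)"
      by (rule integrable_bits)
    show "(\<integral>\<omega>. (edist d (report x 0) (quad_grad \<mu> (\<lambda>_. 0) x))\<^sup>2 \<partial>bits n p) \<le> \<sigma>\<^sup>2"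
      by (simp add: report_0[symmetric] edist_report)
  qed
  moreover have "(1 - \<delta>) * real n \<le> real (card {K..<n})"
    using K_le K_le_n by (simp add: of_nat_diff algebra_simps)
  ultimately show ?thesis
    unfolding is_robust_instance_def
    using quad_smooth[OF \<mu> zero_in] quad_nonneg[of \<mu> d "\<lambda>_. 0"] \<mu> report_in
    by (auto simp: attacked_def intro: less_imp_le)
qed

text \<open>Induction over the rounds: transcripts that agree up to order give the same next
  parameter, and at a common parameter the reports of the new round again form the same multiset.
  Well-formedness of the noisy transcript is carried along because invariance speaks only about
  transcripts.\<close>

lemma transcripts_indistinguishable:
  assumes alg: "is_algorithm d n Alg" "permutation_invariant d n Alg"
    and \<omega>: "\<And>r. r < s \<Longrightarrow> \<omega> r \<in> space (bits n p) \<and> ones n (\<omega> r) \<le> K"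
  shows "is_transcript d n (run_transcript n Alg noisy \<omega> s) \<and>
    list_all2 (\<lambda>R R'. mset R = mset R')
      (run_transcript n Alg attacked \<omega> s) (run_transcript n Alg noisy \<omega> s)"
  using \<omega>
proof (induction s)
  case 0
  then show ?case by (simp add: is_transcript_def)
next
  case (Suc s)
  define H where "H = run_transcript n Alg noisy \<omega> s"
  define H' where "H' = run_transcript n Alg attacked \<omega> s"
  have IH: "is_transcript d n H" "list_all2 (\<lambda>R R'. mset R = mset R') H' H"
    using Suc unfolding H_def H'_def by auto
  have same: "Alg H' = Alg H"
    by (rule permutation_invariantD[OF alg(2) IH])
  have x: "Alg H \<in> Rn d"
    using alg(1) IH(1) by (auto simp: is_algorithm_def)
  have noisy_step: "run_transcript n Alg noisy \<omega> (Suc s)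
      = H @ [map (\<lambda>i. report (Alg H) (\<omega> s i)) [0..<n]]"
    by (simp add: H_def Let_def noisy_def)
  have attacked_step: "run_transcript n Alg attacked \<omega> (Suc s)
      = H' @ [map (\<lambda>i. report (Alg H) (of_bool (i < ones n (\<omega> s)))) [0..<n]]"
  proof -
    have "run_transcript n Alg attacked \<omega> (Suc s)
        = H' @ [map (\<lambda>i. if i \<in> good attacked then sgrad attacked i (Alg H) (\<omega> s)
            else byz attacked H' (Alg H) (map \<omega> [0..<Suc s]) i) [0..<n]]"
      by (simp add: H'_def[symmetric] Let_def same)
    \<comment> \<open>A good worker has \<open>i \<ge> K \<ge> ones n (\<omega> s)\<close>, so its
      exact gradient is the report with bit 0 and one formula covers all workers.\<close>
    also have "\<dots> = H' @ [map (\<lambda>i. report (Alg H) (of_bool (i < ones n (\<omega> s)))) [0..<n]]"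
      using Suc.prems[of s] by (auto simp: attacked_def)
    finally show ?thesis .
  qed
  have "mset (map (\<lambda>i. of_bool (i < ones n (\<omega> s))) [0..<n]) = mset (map (\<omega> s) [0..<n])"
    by (rule mset_bits) (use Suc.prems[of s] in auto)
  then have "mset (map (report (Alg H)) (map (\<lambda>i. of_bool (i < ones n (\<omega> s))) [0..<n]))
      = mset (map (report (Alg H)) (map (\<omega> s) [0..<n]))"
    by (simp only: mset_map)
  then have "list_all2 (\<lambda>R R'. mset R = mset R')
      [map (\<lambda>i. report (Alg H) (of_bool (i < ones n (\<omega> s)))) [0..<n]]
      [map (\<lambda>i. report (Alg H) (\<omega> s i)) [0..<n]]"
    by (simp only: map_map comp_def list_all2_Cons list_all2_Nil simp_thms)
  then show ?case
    unfolding noisy_step attacked_step using IH report_in[OF x]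
    by (auto simp: is_transcript_def intro: list_all2_appendI)
qed

section \<open>From common outputs to a bound on the sum of the errors\<close>

lemma outputs_indistinguishable:
  assumes alg: "is_algorithm d n Alg" "permutation_invariant d n Alg"
    and \<omega>: "\<And>r. r < s \<Longrightarrow> \<omega> r \<in> space (bits n p) \<and> ones n (\<omega> r) \<le> K"
  shows "run_output n Alg attacked s \<omega> = run_output n Alg noisy s \<omega>"
proof -
  have "is_transcript d n (run_transcript n Alg noisy \<omega> s) \<and>
    list_all2 (\<lambda>R R'. mset R = mset R')
      (run_transcript n Alg attacked \<omega> s) (run_transcript n Alg noisy \<omega> s)"
    using alg \<omega> by (rule transcripts_indistinguishable)
  then show ?thesis
    unfolding run_output_def by (blast intro: permutation_invariantD[OF alg(2)])
qed

text \<open>No point is near both minimizers: in coordinate 0 the sum of the two parabolas is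
  smallest at the midpoint \<open>center 0 / 2\<close>.\<close>

lemma quad_sum_ge: "\<sigma>\<^sup>2 * p / (4 * \<mu>) \<le> quad d \<mu> center x + quad d \<mu> (\<lambda>_. 0) x"
proof -
  have "\<sigma>\<^sup>2 * p / (4 * \<mu>) = \<mu> / 4 * (center 0)\<^sup>2"
    using \<mu> unfolding G_sq[symmetric] center_def by (simp add: power2_eq_square field_simps)
  also have "\<dots> \<le> \<mu> / 2 * (x 0 - center 0)\<^sup>2 + \<mu> / 2 * (x 0 - 0)\<^sup>2"
  proof -
    \<comment> \<open>A quarter of this square is the difference of the two sides.\<close>
    have "0 \<le> \<mu> * (center 0 - 2 * x 0)\<^sup>2" using \<mu> by simp
    then show ?thesis by (simp add: power2_eq_square algebra_simps)
  qed
  also have "\<dots> \<le> quad d \<mu> center x + quad d \<mu> (\<lambda>_. 0) x"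
    using \<mu> d quad_ge_coordinate[of \<mu> 0 d x center] quad_ge_coordinate[of \<mu> 0 d x "\<lambda>_. 0"]
    by (intro add_mono) auto
  finally show ?thesis .
qed

text \<open>Both expectations are integrals over the same space. On the event \<open>E\<close> the
  outputs coincide and \<open>quad_sum_ge\<close> applies; outside it both errors are nonnegative.
  Since \<open>E\<close> has probability at least 1/2, half of the pointwise bound survives.\<close>

lemma expected_sum_ge:
  assumes alg: "is_algorithm d n Alg" "permutation_invariant d n Alg" and t: "1 \<le> t"
    and large: "2 * p * n + 2 * (1 + ln (real t)) \<le> \<delta> * n"
  shows "\<sigma>\<^sup>2 * p / (8 * \<mu>) \<le> (\<integral>\<omega>. obj noisy (run_output n Alg noisy t \<omega>) \<partial>run_space noisy t)
    + (\<integral>\<omega>. obj attacked (run_output n Alg attacked t \<omega>) \<partial>run_space attacked t)"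
proof -
  let ?M = "run_space noisy t"
  let ?f = "\<lambda>\<omega>. obj noisy (run_output n Alg noisy t \<omega>)"
  let ?g = "\<lambda>\<omega>. obj attacked (run_output n Alg attacked t \<omega>)"
  have seed: "seed noisy = bits n p" by (simp add: noisy_def)
  have M: "run_space attacked t = ?M"
    by (simp add: run_space_def noisy_def attacked_def)
  interpret prob_space ?M by (rule prob_space_run_space[OF seed])
  define E where "E = {..<t} \<rightarrow>\<^sub>E {\<omega>\<in>space (bits n p). real (ones n \<omega>) < \<delta> * n}"
  have E_sets: "E \<in> sets ?M"
    unfolding sets_run_space[OF seed] space_run_space[OF seed] E_def by (auto intro: PiE_mono)
  have "\<sigma>\<^sup>2 * p / (4 * \<mu>) * indicator E \<omega> \<le> ?f \<omega> + ?g \<omega>" for \<omega>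
  proof (cases "\<omega> \<in> E")
    case True
    have "\<omega> r \<in> space (bits n p) \<and> ones n (\<omega> r) \<le> K" if "r < t" for r
    proof -
      have "\<omega> r \<in> {\<omega>\<in>space (bits n p). real (ones n \<omega>) < \<delta> * n}"
        using True that unfolding E_def by auto
      \<comment> \<open>The number of ones is an integer below \<open>\<delta> * n\<close>, hence
        below \<open>K + 1\<close>.\<close>
      then show ?thesis using less_Suc_K by auto
    qed
    then have "run_output n Alg attacked t \<omega> = run_output n Alg noisy t \<omega>"
      by (rule outputs_indistinguishable[OF alg])
    then show ?thesis
      using quad_sum_ge True by (simp add: noisy_def attacked_def)
  next
    case False
    then show ?thesis using \<mu> by (simp add: noisy_def attacked_def quad_nonneg)
  qed
  then have "(\<integral>\<omega>. \<sigma>\<^sup>2 * p / (4 * \<mu>) * indicator E \<omega> \<partial>?M) \<le> (\<integral>\<omega>. ?f \<omega> + ?g \<omega> \<partial>?M)"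
    by (intro integral_mono integrable_run_space[OF seed])
  also have "\<dots> = (\<integral>\<omega>. ?f \<omega> \<partial>?M) + (\<integral>\<omega>. ?g \<omega> \<partial>?M)"
    by (intro Bochner_Integration.integral_add integrable_run_space[OF seed])
  also have "(\<integral>\<omega>. \<sigma>\<^sup>2 * p / (4 * \<mu>) * indicator E \<omega> \<partial>?M) = \<sigma>\<^sup>2 * p / (4 * \<mu>) * measure ?M E"
    using E_sets by (subst integral_mult_right_zero) (simp add: sets.Int_space_eq2)
  finally have "\<sigma>\<^sup>2 * p / (4 * \<mu>) * measure ?M E \<le> (\<integral>\<omega>. ?f \<omega> \<partial>?M) + (\<integral>\<omega>. ?g \<omega> \<partial>?M)" .
  moreover have "1 / 2 \<le> measure ?M E"
    unfolding E_def using p t large by (intro few_ones_prob[OF seed]) auto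
  then have "\<sigma>\<^sup>2 * p / (4 * \<mu>) * (1 / 2) \<le> \<sigma>\<^sup>2 * p / (4 * \<mu>) * measure ?M E"
    using p \<mu> by (intro mult_left_mono) auto
  ultimately show ?thesis unfolding M by simp
qed

end

theorem theorem2:
  shows "\<exists>\<kappa>::real. \<kappa> > 0 \<and>
    (\<forall>(t::nat) (\<mu>::real) (\<sigma>::real) (\<delta>::real) (n::nat) (d::nat) (Alg::algorithm).
       t \<ge> 1 \<and> \<mu> > 0 \<and> \<sigma> \<ge> 0 \<and> 0 \<le> \<delta> \<and> \<delta> \<le> 1 \<and>
       \<delta> * real n \<ge> 4 * (1 + ln (real t)) \<and>
       d \<ge> 1 \<and> is_algorithm d n Alg \<and> permutation_invariant d n Alg \<longrightarrow>
       (\<exists>(I::robust_instance) (xstar::vec).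
          is_robust_instance d n \<delta> \<sigma> I \<and>
          strongly_convex d \<mu> (obj I) \<and>
          is_arg_min (obj I) (\<lambda>x. x \<in> Rn d) xstar \<and>
          random_run n Alg I t \<and>
          integrable (run_space I t) (\<lambda>\<omega>. obj I (run_output n Alg I t \<omega>)) \<and>
          (\<integral>\<omega>. obj I (run_output n Alg I t \<omega>) \<partial>run_space I t) - obj I xstar
            \<ge> \<kappa> * (\<delta> * \<sigma>\<^sup>2 / \<mu>)))"
proof (intro exI[of _ "1 / 64 :: real"] conjI allI impI; (elim conjE)?)
  fix t n d :: nat and \<mu> \<sigma> \<delta> :: real and Alg :: algorithm
  assume t: "1 \<le> t" and \<mu>: "0 < \<mu>" and \<delta>: "0 \<le> \<delta>" "\<delta> \<le> 1"
    and large: "\<delta> * real n \<ge> 4 * (1 + ln (real t))"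
    and d: "1 \<le> d" and alg: "is_algorithm d n Alg" "permutation_invariant d n Alg"
  \<comment> \<open>Positivity of \<open>\<delta>\<close> makes the bit probability
    \<open>\<delta> / 4\<close> positive, as the scale \<open>G\<close> requires.\<close>
  have "\<delta> \<noteq> 0"
  proof
    assume "\<delta> = 0"
    moreover have "0 \<le> ln (real t)" using t by (intro ln_ge_zero) simp
    ultimately show False using large by simp
  qed
  then interpret lower_bound d n \<mu> \<sigma> \<delta> "\<delta> / 4"
    using d \<mu> \<delta> by unfold_locales auto
  have seed: "seed noisy = bits n (\<delta> / 4)" "seed attacked = bits n (\<delta> / 4)"
    by (simp_all add: noisy_def attacked_def)
  have obj: "obj noisy = quad d \<mu> center" "obj attacked = quad d \<mu> (\<lambda>_. 0)"
    by (simp_all add: noisy_def attacked_def)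
  let ?E = "\<lambda>I. \<integral>\<omega>. obj I (run_output n Alg I t \<omega>) \<partial>run_space I t"
  \<comment> \<open>With bit probability \<open>\<delta> / 4\<close> the first summand is half of
    the right-hand side, and the assumption on \<open>n\<close> bounds the second by the other
    half.\<close>
  have "2 * (\<delta> / 4) * n + 2 * (1 + ln (real t)) \<le> \<delta> * n" using large by simp
  then have "\<sigma>\<^sup>2 * (\<delta> / 4) / (8 * \<mu>) \<le> ?E noisy + ?E attacked"
    by (rule expected_sum_ge[OF alg t])
  \<comment> \<open>The sum of the two expected errors is at least 1/32 of
    \<open>\<delta> * \<sigma>^2 / \<mu>\<close>, so one of them is at least half of that, whence
    1/64. Which instance is hard depends on the algorithm.\<close>
  moreover have "\<sigma>\<^sup>2 * (\<delta> / 4) / (8 * \<mu>) = 2 * (1 / 64 * (\<delta> * \<sigma>\<^sup>2 / \<mu>))" by simp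
  ultimately consider "1 / 64 * (\<delta> * \<sigma>\<^sup>2 / \<mu>) \<le> ?E noisy" | "1 / 64 * (\<delta> * \<sigma>\<^sup>2 / \<mu>) \<le> ?E attacked"
    by linarith
  then show "\<exists>I xstar. is_robust_instance d n \<delta> \<sigma> I \<and> strongly_convex d \<mu> (obj I) \<and>
      is_arg_min (obj I) (\<lambda>x. x \<in> Rn d) xstar \<and> random_run n Alg I t \<and>
      integrable (run_space I t) (\<lambda>\<omega>. obj I (run_output n Alg I t \<omega>)) \<and>
      1 / 64 * (\<delta> * \<sigma>\<^sup>2 / \<mu>) \<le> ?E I - obj I xstar"
  proof cases
    case 1
    then show ?thesis
      using noisy_is_instance quad_strongly_convex quad_is_arg_min[OF _ center_in] \<mu>
        random_run_bits[OF seed(1)] integrable_run_space[OF seed(1)]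
      by (intro exI[of _ noisy] exI[of _ center] conjI) (simp_all add: obj)
  next
    case 2
    then show ?thesis
      using attacked_is_instance quad_strongly_convex quad_is_arg_min[OF _ zero_in] \<mu>
        random_run_bits[OF seed(2)] integrable_run_space[OF seed(2)]
      by (intro exI[of _ attacked] exI[of _ "\<lambda>_. 0"] conjI) (simp_all add: obj)
  qed
qed simp

end
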